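(* Let $n\in\mathbb{N}$, let $X_1,\ldots,X_n$ be real-valued random variables with distributions $F_1,\ldots,F_n\in\mathcal{D}$ respectively, and let $\Theta_1,\ldots,\Theta_n$ be non-negative random variables, non-degenerate at zero. Suppose that: (i) there exist functions $b_i:[0,\infty)\to(0,\infty)$, $i=1,\ldots,n$, such that $b_i(x)\to\infty$ and $b_i(x)/x\to 0$ as $x\to\infty$, and, for all $1\le i\ne j\le n$, $$\mathbf{P}[\Theta_i>b_i(x_i)]=o\big(\mathbf{P}[\Theta_iX_i>x_i,\ \Theta_jX_j>x_j]\big)\quad\text{as } x_i\wedge x_j\to\infty;$$ (ii) for each $i=1,\ldots,n$ there exists a function $h_i:[0,\infty)\to(0,\infty)$ such that $$\mathbf{P}[X_i>x\mid\Theta_i=\theta]\sim h_i(\theta)\,\mathbf{P}[X_i>x]\quad\text{as }x\to\infty,\ \text{uniformly for }\theta\in s_{\Theta_i};$$ (iii) there exist measurable functions $g_{ij}:[0,\infty)^2\to(0,\infty)$, $1\le i\ne j\le n$, and constants $0<L\le U<\infty$ such that, for all $1\le i\neq j\le n$, as $x_i\wedge x_j\to\infty$, uniformly for $(\theta_i,\theta_j)\in s_{\Theta_i}\times s_{\Theta_j}$, $$\mathbf{P}[|X_i|>x_i,\ X_j>x_j\mid\Theta_i=\theta_i,\Theta_j=\theta_j]\sim g_{ij}(\theta_i,\theta_j)\,\mathbf{P}[|X_i|>x_i,\ X_j>x_j]$$ and $$L\,g_{ij}(\theta_i,\theta_j)\mathbf{P}[X_i>x_i,X_j>x_j]\lesssim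 \mathbf{P}[X_i>x_i,X_j>x_j\mid\Theta_i=\theta_i,\Theta_j=\theta_j]\lesssim U\,g_{ij}(\theta_i,\theta_j)\mathbf{P}[X_i>x_i,X_j>x_j].$$ If $X_1,\ldots,X_n$ are pTAI, then the products $\Theta_1X_1,\ldots,\Theta_nX_n$ are pTAI. If $X_1,\ldots,X_n$ are pQAI, then the products $\Theta_1X_1,\ldots,\Theta_nX_n$ are pQAI.
   Context: For a distribution $F$, $\overline F(x)=1-F(x)$; throughout $\overline F_i(x)>0$ for all $x\ge0$ and all $i$. "Non-degenerate at zero" means not almost surely equal to $0$. $x\wedge y=\min\{x,y\}$, $x\vee y=\max\{x,y\}$, $x^+=\max\{x,0\}$, $x^-=-\min\{x,0\}$. $f=o(g)$ means $f/g\to0$; $f\sim g$ means $f/g\to1$; $f\lesssim g$ means $\limsup f/g\le1$; $f\gtrsim g$ means $\liminf f/g\ge1$. Uniformity of $\sim$ over $\theta$ means that the supremum over $\theta$ of $|f/g-1|$ tends to $0$; uniformity of $\lesssim$ means $\limsup$ of the supremum over $\theta$ of the ratio $f/g$ is $\le1$. Support: $s_{\Theta_i}=\{\theta\in\mathbb{R}:\mathbf{P}(\Theta_i\in[\theta-\delta,\theta+\delta])>0\text{ for any }\delta>0\}$. For an event $A$, $\mathbf{P}[A\mid\Theta_i=\theta_i,\Theta_j=\theta_j]$ is defined as $$\lim_{\delta\downarrow0}\frac{\mathbf{P}[A,\ \Theta_i\in[\theta_i-\delta,\theta_i+\delta],\ \Theta_j\in[\theta_j-\delta,\theta_j+\delta]]}{\mathbf{P}[\Theta_i\in[\theta_i-\delta,\theta_i+\delta],\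 \Theta_j\in[\theta_j-\delta,\theta_j+\delta]]},$$ and $\mathbf{P}[A\mid\Theta_i=\theta]$ is defined analogously with a single weight. Class $\mathcal{D}$ (dominatedly varying): $F\in\mathcal{D}$ if $\limsup_{x\to\infty}\overline F(bx)/\overline F(x)<\infty$ for any (equivalently, some) $b\in(0,1)$. Real-valued random variables $Y_1,\ldots,Y_n$ are pTAI (pairwise tail asymptotically independent) if for all $i\ne j$, $\lim_{x_i\wedge x_j\to\infty}\mathbf{P}[|Y_i|>x_i\mid Y_j>x_j]=0$. They are pQAI (pairwise quasi-asymptotically independent) if for all $i\neq j$, $$\lim_{x\to\infty}\frac{\mathbf{P}[Y_i^+>x,\,Y_j^+>x]}{\mathbf{P}[Y_i>x]+\mathbf{P}[Y_j>x]}=\lim_{x\to\infty}\frac{\mathbf{P}[Y_i^->x,\,Y_j>x]}{\mathbf{P}[Y_i>x]+\mathbf{P}[Y_j>x]}=0.$$ *)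

theory Defs
  imports "HOL-Probability.Probability" "HOL-Library.Landau_Symbols"
begin

definition tail :: "(real \<Rightarrow> real) \<Rightarrow> real \<Rightarrow> real" where
  "tail F x = 1 - F x"

definition dominatedly_varying :: "(real \<Rightarrow> real) \<Rightarrow> bool" where
  "dominatedly_varying F \<longleftrightarrow>
     (\<forall>b\<in>{0<..<1}. Limsup at_top (\<lambda>x. ereal (tail F (b * x) / tail F x)) < \<infinity>)"

definition rv_support :: "'a measure \<Rightarrow> ('a \<Rightarrow> real) \<Rightarrow> real set" where
  "rv_support M T = {\<theta>. \<forall>\<delta>>0. \<P>(\<omega> in M. T \<omega> \<in> {\<theta> - \<delta>..\<theta> + \<delta>}) > 0}"

text \<open>The limit \<open>x \<and> y \<longrightarrow> \<infinity>\<close> for a pair \<open>(x, y)\<close>.\<close>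

definition min_at_top :: "(real \<times> real) filter" where
  "min_at_top = filtercomap (\<lambda>(x, y). min x y) at_top"

text \<open>
  Conditional probabilities given the values of one or two random variables are limits of
  elementary conditional probabilities. \<open>Lim\<close> is unspecified when no limit exists, and
  \<^const>\<open>cond_prob\<close> is \<open>0\<close> when the conditioning event is null, so the accompanying
  \<open>_defined\<close> predicates state that the defining quotients and their limit make sense.
\<close>

definition cond_prob_at ::
  "'a measure \<Rightarrow> ('a \<Rightarrow> bool) \<Rightarrow> ('a \<Rightarrow> real) \<Rightarrow> real \<Rightarrow> real" where
  "cond_prob_at M A T \<theta> =
     Lim (at_right 0) (\<lambda>\<delta>. \<P>(\<omega> in M. A \<omega> \<bar> T \<omega> \<in> {\<theta> - \<delta>..\<theta> + \<delta>}))"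

definition cond_prob_at_defined ::
  "'a measure \<Rightarrow> ('a \<Rightarrow> bool) \<Rightarrow> ('a \<Rightarrow> real) \<Rightarrow> real \<Rightarrow> bool" where
  "cond_prob_at_defined M A T \<theta> \<longleftrightarrow>
     (\<forall>\<delta>>0. \<P>(\<omega> in M. T \<omega> \<in> {\<theta> - \<delta>..\<theta> + \<delta>}) > 0) \<and>
     (\<exists>p. ((\<lambda>\<delta>. \<P>(\<omega> in M. A \<omega> \<bar> T \<omega> \<in> {\<theta> - \<delta>..\<theta> + \<delta>})) \<longlongrightarrow> p) (at_right 0))"

definition cond_prob_at2 ::
  "'a measure \<Rightarrow> ('a \<Rightarrow> bool) \<Rightarrow> ('a \<Rightarrow> real) \<Rightarrow> ('a \<Rightarrow> real) \<Rightarrow> real \<times> real \<Rightarrow> real" where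
  "cond_prob_at2 M A S T = (\<lambda>(s, t).
     Lim (at_right 0) (\<lambda>\<delta>. \<P>(\<omega> in M. A \<omega> \<bar>
       S \<omega> \<in> {s - \<delta>..s + \<delta>} \<and> T \<omega> \<in> {t - \<delta>..t + \<delta>})))"

definition cond_prob_at2_defined ::
  "'a measure \<Rightarrow> ('a \<Rightarrow> bool) \<Rightarrow> ('a \<Rightarrow> real) \<Rightarrow> ('a \<Rightarrow> real) \<Rightarrow> real \<times> real \<Rightarrow> bool" where
  "cond_prob_at2_defined M A S T = (\<lambda>(s, t).
     (\<forall>\<delta>>0. \<P>(\<omega> in M. S \<omega> \<in> {s - \<delta>..s + \<delta>} \<and> T \<omega> \<in> {t - \<delta>..t + \<delta>}) > 0) \<and>
     (\<exists>p. ((\<lambda>\<delta>. \<P>(\<omega> in M. A \<omega> \<bar>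
       S \<omega> \<in> {s - \<delta>..s + \<delta>} \<and> T \<omega> \<in> {t - \<delta>..t + \<delta>})) \<longlongrightarrow> p) (at_right 0)))"

text \<open>\<open>f x \<theta> \<sim> g x \<theta>\<close> along the filter \<open>G\<close>, uniformly for \<open>\<theta> \<in> S\<close>.\<close>

definition unif_asymp_equiv ::
  "'x filter \<Rightarrow> 't set \<Rightarrow> ('x \<Rightarrow> 't \<Rightarrow> real) \<Rightarrow> ('x \<Rightarrow> 't \<Rightarrow> real) \<Rightarrow> bool" where
  "unif_asymp_equiv G S f g \<longleftrightarrow> uniform_limit S (\<lambda>x \<theta>. f x \<theta> / g x \<theta>) (\<lambda>_. 1) G"

text \<open>
  \<open>f x \<theta> \<lesssim> g x \<theta>\<close> along \<open>G\<close>, uniformly for \<open>\<theta> \<in> S\<close>, for non-negative \<open>f\<close> and \<open>g\<close>.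
  The quotient is taken in \<^typ>\<open>ennreal\<close>, where \<open>a / 0 = \<infinity>\<close> for \<open>a > 0\<close>.
\<close>

definition unif_lesssim ::
  "'x filter \<Rightarrow> 't set \<Rightarrow> ('x \<Rightarrow> 't \<Rightarrow> real) \<Rightarrow> ('x \<Rightarrow> 't \<Rightarrow> real) \<Rightarrow> bool" where
  "unif_lesssim G S f g \<longleftrightarrow>
     Limsup G (\<lambda>x. SUP \<theta>\<in>S. ennreal (f x \<theta>) / ennreal (g x \<theta>)) \<le> 1"

text \<open>
  In the next two definitions the positivity clauses say that the denominators do not vanish;
  they hold automatically for variables whose distributions have positive tails everywhere.
\<close>

definition pTAI :: "'a measure \<Rightarrow> 'i set \<Rightarrow> ('i \<Rightarrow> 'a \<Rightarrow> real) \<Rightarrow> bool" where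
  "pTAI M I Y \<longleftrightarrow> (\<forall>i\<in>I. \<forall>j\<in>I. i \<noteq> j \<longrightarrow>
     (\<forall>\<^sub>F x in at_top. \<P>(\<omega> in M. Y j \<omega> > x) > 0) \<and>
     ((\<lambda>(x\<^sub>i, x\<^sub>j). \<P>(\<omega> in M. \<bar>Y i \<omega>\<bar> > x\<^sub>i \<bar> Y j \<omega> > x\<^sub>j)) \<longlongrightarrow> 0) min_at_top)"

definition pQAI :: "'a measure \<Rightarrow> 'i set \<Rightarrow> ('i \<Rightarrow> 'a \<Rightarrow> real) \<Rightarrow> bool" where
  "pQAI M I Y \<longleftrightarrow> (\<forall>i\<in>I. \<forall>j\<in>I. i \<noteq> j \<longrightarrow>
     (\<forall>\<^sub>F x in at_top. \<P>(\<omega> in M. Y i \<omega> > x) + \<P>(\<omega> in M. Y j \<omega> > x) > 0) \<and>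
     ((\<lambda>x. \<P>(\<omega> in M. max (Y i \<omega>) 0 > x \<and> max (Y j \<omega>) 0 > x) /
           (\<P>(\<omega> in M. Y i \<omega> > x) + \<P>(\<omega> in M. Y j \<omega> > x))) \<longlongrightarrow> 0) at_top \<and>
     ((\<lambda>x. \<P>(\<omega> in M. - min (Y i \<omega>) 0 > x \<and> Y j \<omega> > x) /
           (\<P>(\<omega> in M. Y i \<omega> > x) + \<P>(\<omega> in M. Y j \<omega> > x))) \<longlongrightarrow> 0) at_top)"

end

theory Submission
  imports Defs
begin

text \<open>
  The assumption \<open>b_small\<close> is much stronger than it looks. For \<open>i \<noteq> j\<close> and fixed \<open>x\<^sub>i\<close> its left-hand side does not
  depend on \<open>x\<^sub>j\<close>, while the joint tail on its right-hand side vanishes as \<open>x\<^sub>j\<close> grows; hence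
  \<open>\<P>(\<Theta>\<^sub>i > b\<^sub>i x\<^sub>i) = 0\<close> for some \<open>x\<^sub>i\<close>, so that the weights are essentially bounded, say by \<open>B\<close>
  (\<open>bounded_if_tail_smallo_joint_tail\<close>). Every joint tail of the products at \<open>x, y \<ge> 0\<close> is then
  at most the corresponding joint tail of the \<open>X\<^sub>i\<close> at \<open>(x / B, y / B)\<close>, and asymptotic independence
  of the \<open>X\<^sub>i\<close> makes it negligible against the marginal tails \<open>\<P>(X\<^sub>j > y / B)\<close>.

  What remains is \<open>\<P>(X\<^sub>j > y / B) \<le> C \<P>(\<Theta>\<^sub>j X\<^sub>j > y)\<close> for large \<open>y\<close> (\<open>tail_product_ge\<close>). As
  \<open>\<Theta>\<^sub>j X\<^sub>j > y\<close> holds when \<open>\<Theta>\<^sub>j > a\<close> and \<open>X\<^sub>j > y / a\<close>, and dominated variation bounds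
  \<open>\<P>(X\<^sub>j > y / B)\<close> by a multiple of \<open>\<P>(X\<^sub>j > y / a)\<close>, it is enough that
  \<open>\<P>(X\<^sub>j > y, \<Theta>\<^sub>j > a) \<ge> c \<P>(X\<^sub>j > y)\<close> for some \<open>a, c > 0\<close> and all large \<open>y\<close>
  (\<open>joint_tail_ge_marginal_tail\<close>).

  This last bound comes from \<open>h_asymp\<close>. Write \<open>\<nu>\<^sub>y(I) = \<P>(X\<^sub>j > y, \<Theta>\<^sub>j \<in> I)\<close> and fix a large \<open>K\<close>. By
  the uniform asymptotics the derivative of \<open>\<nu>\<^sub>y\<close> with respect to \<open>\<nu>\<^sub>K\<close> along centred intervals is
  more than \<open>\<P>(X\<^sub>j > y) / (3 \<P>(X\<^sub>j > K))\<close> at every positive point of the support; the unknown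
  \<open>h\<^sub>j\<close> cancels, so neither its measurability nor a lower bound on it is needed. A covering
  argument on the line, in which a finite cover by intervals is thinned to one that covers no
  point more than twice, turns this into the inequality
  \<open>\<nu>\<^sub>K(I) \<P>(X\<^sub>j > y) \<le> 6 \<P>(X\<^sub>j > K) \<nu>\<^sub>y(J)\<close> for a compact interval \<open>I\<close> of
  positive numbers with \<open>\<nu>\<^sub>K(I) > 0\<close> and a slightly larger interval \<open>J\<close>.
\<close>

section \<open>Comparison of measures by centred intervals\<close>

lemma interval_thinning:
  fixes l r :: "'i \<Rightarrow> real"
  assumes "finite C"
  obtains G where "G \<subseteq> C" "(\<Union>k\<in>G. {l k..r k}) = (\<Union>k\<in>C. {l k..r k})"
    "\<And>x. card {k\<in>G. x \<in> {l k..r k}} \<le> 2"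
proof -
  \<comment> \<open>A subfamily of least cardinality with the same union has no redundant member.\<close>
  define Q where "Q G \<longleftrightarrow> G \<subseteq> C \<and> (\<Union>k\<in>G. {l k..r k}) = (\<Union>k\<in>C. {l k..r k})" for G
  have "Q C" by (simp add: Q_def)
  then obtain G where G: "Q G" and G_min: "\<And>G'. Q G' \<Longrightarrow> card G \<le> card G'"
    using ex_has_least_nat[of Q C card] by blast
  have fin: "finite G" using G assms finite_subset by (auto simp: Q_def)
  have "card {k\<in>G. x \<in> {l k..r k}} \<le> 2" for x
  proof (rule ccontr)
    define H where "H = {k\<in>G. x \<in> {l k..r k}}"
    assume "\<not> card {k\<in>G. x \<in> {l k..r k}} \<le> 2"
    then have H3: "card H > 2" by (simp add: H_def)
    have H: "finite H" "H \<noteq> {}" using H3 card_ge_0_finite[of H] by auto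
    obtain p where p: "p \<in> H" "\<And>k. k \<in> H \<Longrightarrow> l p \<le> l k"
      using arg_min_if_finite[OF H, of l] by (metis not_le)
    obtain q where q: "q \<in> H" "\<And>k. k \<in> H \<Longrightarrow> r k \<le> r q"
      using arg_min_if_finite[OF H, of "\<lambda>k. - r k"] by (metis neg_less_iff_less not_le)
    have "\<not> H \<subseteq> {p, q}"
      using H3 card_mono[of "{p, q}" H] card_insert_le_m1[of 2 "{q}" p] by auto
    then obtain k where k: "k \<in> H" "k \<noteq> p" "k \<noteq> q" by auto
    \<comment> \<open>All intervals of \<open>H\<close> share \<open>x\<close>, so the \<open>p\<close>-th and the \<open>q\<close>-th cover the \<open>k\<close>-th.\<close>
    have "{l k..r k} \<subseteq> {l p..r p} \<union> {l q..r q}"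
      using p(1) q(1) p(2)[OF k(1)] q(2)[OF k(1)] by (auto simp: H_def)
    moreover have "p \<in> G - {k}" "q \<in> G - {k}"
      using p q k by (auto simp: H_def)
    ultimately have "(\<Union>k\<in>G - {k}. {l k..r k}) = (\<Union>k\<in>G. {l k..r k})"
      by blast
    with G have "Q (G - {k})" by (auto simp: Q_def)
    from G_min[OF this] k fin show False
      using card_Diff1_less[of G k] by (auto simp: H_def)
  qed
  with G that show thesis by (auto simp: Q_def)
qed

context finite_measure
begin

lemma sum_measure_le_overlap:
  assumes fin: "finite G" and meas: "\<And>k. k \<in> G \<Longrightarrow> A k \<in> sets M" and J: "J \<in> sets M"
    and sub: "\<And>k. k \<in> G \<Longrightarrow> A k \<subseteq> J"
    and ov: "\<And>\<omega>. card {k\<in>G. \<omega> \<in> A k} \<le> m"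
  shows "(\<Sum>k\<in>G. measure M (A k)) \<le> real m * measure M J"
proof -
  have int: "integrable M (indicator (A k) :: 'a \<Rightarrow> real)" if "k \<in> G" for k
    using meas[OF that] by (simp add: emeasure_eq_measure)
  have "(\<Sum>k\<in>G. measure M (A k)) = (\<Sum>k\<in>G. integral\<^sup>L M (indicator (A k)))"
    using meas sets.sets_into_space by (intro sum.cong) (auto simp: Int_absorb2)
  also have "\<dots> = integral\<^sup>L M (\<lambda>\<omega>. \<Sum>k\<in>G. indicator (A k) \<omega>)"
    using int by (simp add: Bochner_Integration.integral_sum)
  also have "\<dots> \<le> integral\<^sup>L M (\<lambda>\<omega>. real m * indicator J \<omega>)"
  proof (rule integral_mono)
    show "integrable M (\<lambda>\<omega>. \<Sum>k\<in>G. indicator (A k) \<omega> :: real)"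
      using int by auto
    show "integrable M (\<lambda>\<omega>. real m * indicator J \<omega>)"
      using J by (simp add: emeasure_eq_measure)
    fix \<omega>
    have "(\<Sum>k\<in>G. indicator (A k) \<omega> :: real) = real (card {k\<in>G. \<omega> \<in> A k})"
      using fin by (simp add: indicator_def sum.If_cases Int_def)
    moreover have "\<omega> \<notin> J \<Longrightarrow> {k\<in>G. \<omega> \<in> A k} = {}" using sub by auto
    ultimately show "(\<Sum>k\<in>G. indicator (A k) \<omega>) \<le> real m * indicator J \<omega>"
      using ov[of \<omega>] by (auto simp: indicator_def)
  qed
  also have "\<dots> = real m * measure M J"
    using J sets.sets_into_space by (simp add: Int_absorb2)
  finally show ?thesis .
qed

text \<open>
  A one-dimensional differentiation argument: an inequality between two measures on one small
  interval around each point of \<open>{p..q}\<close> passes to \<open>{p..q}\<close>. The factor 2 is the overlap of the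
  thinned cover, and the interval on the right grows by \<open>e\<close> because the centred intervals may
  stick out of \<open>{p..q}\<close>. The measures are the images under \<open>T\<close> of \<open>M\<close> restricted to \<open>P\<close> and
  to \<open>Q\<close>.
\<close>

lemma measure_compare_centred_intervals:
  fixes T :: "'a \<Rightarrow> real"
  assumes T[measurable]: "T \<in> borel_measurable M"
    and P[measurable]: "Measurable.pred M P" and Q[measurable]: "Measurable.pred M Q"
    and c: "0 \<le> c"
    and loc: "\<And>t. t \<in> {p..q} \<Longrightarrow> \<exists>\<delta>. 0 < \<delta> \<and> \<delta> \<le> e \<and>
      c * measure M {\<omega>\<in>space M. P \<omega> \<and> T \<omega> \<in> {t - \<delta>..t + \<delta>}}
        \<le> measure M {\<omega>\<in>space M. Q \<omega> \<and> T \<omega> \<in> {t - \<delta>..t + \<delta>}}"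
  shows "c * measure M {\<omega>\<in>space M. P \<omega> \<and> T \<omega> \<in> {p..q}}
    \<le> 2 * measure M {\<omega>\<in>space M. Q \<omega> \<and> T \<omega> \<in> {p - e..q + e}}"
proof -
  define E where "E R l r = {\<omega>\<in>space M. R \<omega> \<and> T \<omega> \<in> {l..r}}" for R and l r :: real
  have E_sets[measurable]: "E P l r \<in> sets M" "E Q l r \<in> sets M" for l r
    unfolding E_def by measurable
  have "\<forall>t\<in>{p..q}. \<exists>\<delta>. 0 < \<delta> \<and> \<delta> \<le> e \<and>
      c * measure M (E P (t - \<delta>) (t + \<delta>)) \<le> measure M (E Q (t - \<delta>) (t + \<delta>))"
    unfolding E_def using loc by blast
  from bchoice[OF this] obtain d where d: "\<And>t. t \<in> {p..q} \<Longrightarrow> 0 < d t" "\<And>t. t \<in> {p..q} \<Longrightarrow> d t \<le> e"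
    "\<And>t. t \<in> {p..q} \<Longrightarrow>
      c * measure M (E P (t - d t) (t + d t)) \<le> measure M (E Q (t - d t) (t + d t))"
    by blast
  have "compact {p..q}" by simp
  moreover have "{p..q} \<subseteq> (\<Union>t\<in>{p..q}. {t - d t<..<t + d t})"
  proof
    fix t assume "t \<in> {p..q}"
    then show "t \<in> (\<Union>t\<in>{p..q}. {t - d t<..<t + d t})"
      using d(1)[of t] by (intro UN_I[of t]) auto
  qed
  ultimately obtain C where C: "C \<subseteq> {p..q}" "finite C" "{p..q} \<subseteq> (\<Union>t\<in>C. {t - d t<..<t + d t})"
    using compactE_image[of "{p..q}" "{p..q}" "\<lambda>t. {t - d t<..<t + d t}"]
    by (metis open_greaterThanLessThan)
  obtain G where G: "G \<subseteq> C" "(\<Union>t\<in>G. {t - d t..t + d t}) = (\<Union>t\<in>C. {t - d t..t + d t})"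
    "\<And>x. card {t\<in>G. x \<in> {t - d t..t + d t}} \<le> 2"
    using interval_thinning[OF C(2), of "\<lambda>t. t - d t" "\<lambda>t. t + d t"] by blast
  have fin: "finite G" using G(1) C(2) by (rule finite_subset)
  have cov: "{p..q} \<subseteq> (\<Union>t\<in>G. {t - d t..t + d t})"
    unfolding G(2) using C(3) by (rule order_trans) (intro UN_mono, auto)
  have Gpq: "t \<in> {p..q}" if "t \<in> G" for t using that G(1) C(1) by blast
  have "measure M (E P p q) \<le> measure M (\<Union>t\<in>G. E P (t - d t) (t + d t))"
  proof (rule finite_measure_mono)
    show "E P p q \<subseteq> (\<Union>t\<in>G. E P (t - d t) (t + d t))"
    proof
      fix \<omega> assume \<omega>: "\<omega> \<in> E P p q"
      then have "T \<omega> \<in> (\<Union>t\<in>G. {t - d t..t + d t})" using cov by (auto simp only: E_def)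
      with \<omega> show "\<omega> \<in> (\<Union>t\<in>G. E P (t - d t) (t + d t))" by (simp add: E_def)
    qed
  qed (use fin in \<open>auto intro!: sets.finite_UN\<close>)
  also have "\<dots> \<le> (\<Sum>t\<in>G. measure M (E P (t - d t) (t + d t)))"
    using fin by (intro finite_measure_subadditive_finite) auto
  finally have "c * measure M (E P p q) \<le> (\<Sum>t\<in>G. c * measure M (E P (t - d t) (t + d t)))"
    using c by (simp add: mult_left_mono flip: sum_distrib_left)
  also have "\<dots> \<le> (\<Sum>t\<in>G. measure M (E Q (t - d t) (t + d t)))"
    using d(3) Gpq by (intro sum_mono) auto
  also have "\<dots> \<le> real 2 * measure M (E Q (p - e) (q + e))"
  proof (rule sum_measure_le_overlap[OF fin])
    show "E Q (t - d t) (t + d t) \<subseteq> E Q (p - e) (q + e)" if "t \<in> G" for t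
      using Gpq[OF that] d(2)[OF Gpq[OF that]] by (auto simp: E_def)
    show "card {t\<in>G. \<omega> \<in> E Q (t - d t) (t + d t)} \<le> 2" for \<omega>
      by (rule order_trans[OF card_mono G(3)[of "T \<omega>"]]) (use fin in \<open>auto simp: E_def\<close>)
  qed auto
  finally show ?thesis by (simp add: E_def)
qed

end

section \<open>Lower bound for the tail of a product\<close>

context prob_space
begin

lemma AE_not_if_prob_0:
  assumes "{\<omega>\<in>space M. P \<omega>} \<in> events" "\<P>(\<omega> in M. P \<omega>) = 0"
  shows "AE \<omega> in M. \<not> P \<omega>"
proof -
  from assms have "AE \<omega> in M. \<omega> \<notin> {\<omega>\<in>space M. P \<omega>}" by (simp only: prob_eq_0)
  with AE_space show ?thesis by eventually_elim simp
qed

lemma measure_null_off_support: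
  fixes T :: "'a \<Rightarrow> real"
  assumes T[measurable]: "T \<in> borel_measurable M" and "t \<notin> rv_support M T"
  obtains \<delta>0 where "\<delta>0 > 0"
    "\<And>\<delta>. \<delta> \<le> \<delta>0 \<Longrightarrow> prob {\<omega>\<in>space M. T \<omega> \<in> {t - \<delta>..t + \<delta>}} = 0"
proof -
  from assms obtain \<delta>0 where d: "\<delta>0 > 0" "prob {\<omega>\<in>space M. T \<omega> \<in> {t - \<delta>0..t + \<delta>0}} \<le> 0"
    by (auto simp: rv_support_def not_less)
  have "prob {\<omega>\<in>space M. T \<omega> \<in> {t - \<delta>..t + \<delta>}} = 0" if "\<delta> \<le> \<delta>0" for \<delta>
  proof -
    have "prob {\<omega>\<in>space M. T \<omega> \<in> {t - \<delta>..t + \<delta>}} \<le> prob {\<omega>\<in>space M. T \<omega> \<in> {t - \<delta>0..t + \<delta>0}}"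
      using that by (intro finite_measure_mono) auto
    with d(2) show ?thesis
      using measure_nonneg[of M "{\<omega>\<in>space M. T \<omega> \<in> {t - \<delta>..t + \<delta>}}"] by linarith
  qed
  with d(1) that show thesis by blast
qed

lemma ex_pos_support_point:
  fixes T :: "'a \<Rightarrow> real"
  assumes T[measurable]: "T \<in> borel_measurable M"
    and nonneg: "AE \<omega> in M. T \<omega> \<ge> 0" and nondeg: "\<not> (AE \<omega> in M. T \<omega> = 0)"
  obtains \<theta> where "\<theta> \<in> rv_support M T" "\<theta> > 0"
proof (rule ccontr)
  assume *: "\<not> thesis"
  have "prob {\<omega>\<in>space M. T \<omega> \<in> {1 / Suc m..Suc m}} = 0" for m :: nat
  proof -
    \<comment> \<open>Comparison with the zero measure: every point of the interval has a null neighbourhood.\<close>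
    have "1 * measure M {\<omega>\<in>space M. True \<and> T \<omega> \<in> {1 / Suc m..Suc m}}
      \<le> 2 * measure M {\<omega>\<in>space M. False \<and> T \<omega> \<in> {1 / Suc m - 1..real (Suc m) + 1}}"
    proof (rule measure_compare_centred_intervals)
      fix t assume "t \<in> {1 / real (Suc m)..Suc m}"
      moreover have "0 < 1 / real (Suc m)" by simp
      ultimately have "t > 0" unfolding atLeastAtMost_iff by linarith
      with * that have "t \<notin> rv_support M T" by blast
      from measure_null_off_support[OF T this] obtain \<delta>0 where "\<delta>0 > 0"
        "\<And>\<delta>. \<delta> \<le> \<delta>0 \<Longrightarrow> prob {\<omega>\<in>space M. T \<omega> \<in> {t - \<delta>..t + \<delta>}} = 0" by blast
      then show "\<exists>\<delta>>0. \<delta> \<le> 1 \<and> 1 * prob {\<omega>\<in>space M. True \<and> T \<omega> \<in> {t - \<delta>..t + \<delta>}}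
          \<le> prob {\<omega>\<in>space M. False \<and> T \<omega> \<in> {t - \<delta>..t + \<delta>}}"
        by (intro exI[of _ "min \<delta>0 1"]) auto
    qed auto
    then have "prob {\<omega>\<in>space M. T \<omega> \<in> {1 / Suc m..Suc m}} \<le> 0"
      by (simp del: of_nat_Suc)
    then show ?thesis by (rule order_antisym) simp
  qed
  then have "AE \<omega> in M. \<not> T \<omega> \<in> {1 / Suc m..Suc m}" for m :: nat
    by (intro AE_not_if_prob_0) measurable
  then have "AE \<omega> in M. \<forall>m::nat. \<not> T \<omega> \<in> {1 / Suc m..Suc m}"
    unfolding AE_all_countable by blast
  with nonneg have "AE \<omega> in M. T \<omega> = 0"
  proof eventually_elim
    case (elim \<omega>)
    show ?case
    proof (rule ccontr)
      assume "T \<omega> \<noteq> 0"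
      with elim have pos: "T \<omega> > 0" by simp
      obtain m1 :: nat where m1: "1 / Suc m1 < T \<omega>"
        using pos nat_approx_posE by blast
      obtain m2 :: nat where m2: "T \<omega> < m2" using reals_Archimedean2 by blast
      have "1 / real (Suc (max m1 m2)) \<le> 1 / Suc m1" by (simp add: frac_le)
      with m1 have "1 / real (Suc (max m1 m2)) \<le> T \<omega>" by linarith
      moreover have "T \<omega> \<le> real (Suc (max m1 m2))" using m2 by simp
      ultimately show False using elim(2) by (metis atLeastAtMost_iff)
    qed
  qed
  with nondeg show False by simp
qed

text \<open>
  Large values of \<open>X\<close> do not force \<open>T\<close> to be small: for some \<open>a > 0\<close> the conditional probability of
  \<open>T > a\<close> given \<open>X > y\<close> stays away from \<open>0\<close> as \<open>y\<close> grows.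
\<close>

lemma joint_tail_ge_marginal_tail:
  fixes X T :: "'a \<Rightarrow> real" and h :: "real \<Rightarrow> real"
  assumes X[measurable]: "X \<in> borel_measurable M" and T[measurable]: "T \<in> borel_measurable M"
    and X_tail: "\<And>x. 0 \<le> x \<Longrightarrow> \<P>(\<omega> in M. X \<omega> > x) > 0"
    and nonneg: "AE \<omega> in M. T \<omega> \<ge> 0" and nondeg: "\<not> (AE \<omega> in M. T \<omega> = 0)"
    and h_pos: "\<And>\<theta>. 0 \<le> \<theta> \<Longrightarrow> h \<theta> > 0"
    and h_defined: "\<forall>\<^sub>F x in at_top. \<forall>\<theta>\<in>rv_support M T.
      cond_prob_at_defined M (\<lambda>\<omega>. X \<omega> > x) T \<theta>"
    and h_asymp: "unif_asymp_equiv at_top (rv_support M T)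
      (\<lambda>x \<theta>. cond_prob_at M (\<lambda>\<omega>. X \<omega> > x) T \<theta>) (\<lambda>x \<theta>. h \<theta> * \<P>(\<omega> in M. X \<omega> > x))"
  obtains a c where "a > 0" "c > 0"
    "\<forall>\<^sub>F y in at_top. c * \<P>(\<omega> in M. X \<omega> > y) \<le> \<P>(\<omega> in M. X \<omega> > y \<and> T \<omega> > a)"
proof -
  define S where "S = rv_support M T"
  define p where "p y = \<P>(\<omega> in M. X \<omega> > y)" for y
  define \<mu> where "\<mu> t \<delta> = prob {\<omega>\<in>space M. T \<omega> \<in> {t - \<delta>..t + \<delta>}}" for t \<delta>
  define \<nu> where "\<nu> y t \<delta> = prob {\<omega>\<in>space M. X \<omega> > y \<and> T \<omega> \<in> {t - \<delta>..t + \<delta>}}" for y t \<delta>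
  define \<kappa> where "\<kappa> y t = cond_prob_at M (\<lambda>\<omega>. X \<omega> > y) T t" for y t
  have "\<forall>\<^sub>F y in at_top. \<forall>t\<in>S. dist (\<kappa> y t / (h t * p y)) 1 < 1/2"
    using h_asymp[unfolded unif_asymp_equiv_def uniform_limit_iff, rule_format, of "1/2"]
    by (simp add: S_def \<kappa>_def p_def)
  with h_defined eventually_ge_at_top[of 0]
  have "\<forall>\<^sub>F y in at_top. 0 \<le> y \<and> (\<forall>t\<in>S. cond_prob_at_defined M (\<lambda>\<omega>. X \<omega> > y) T t) \<and>
      (\<forall>t\<in>S. dist (\<kappa> y t / (h t * p y)) 1 < 1/2)"
    by eventually_elim (auto simp: S_def)
  then obtain K where K: "\<And>y. y \<ge> K \<Longrightarrow> 0 \<le> y"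
    "\<And>y t. y \<ge> K \<Longrightarrow> t \<in> S \<Longrightarrow> cond_prob_at_defined M (\<lambda>\<omega>. X \<omega> > y) T t"
    "\<And>y t. y \<ge> K \<Longrightarrow> t \<in> S \<Longrightarrow> dist (\<kappa> y t / (h t * p y)) 1 < 1/2"
    by (auto simp: eventually_at_top_linorder)
  have \<nu>_nonneg: "\<nu> y t \<delta> \<ge> 0" for y t \<delta> by (simp add: \<nu>_def)
  have p_pos: "p y > 0" if "y \<ge> K" for y using X_tail K(1)[OF that] by (simp add: p_def)
  have \<mu>_pos: "\<mu> t \<delta> > 0" if "t \<in> S" "\<delta> > 0" for t \<delta>
    using that by (simp add: S_def rv_support_def \<mu>_def)
  have \<kappa>_bounds: "h t * p y / 2 < \<kappa> y t" "\<kappa> y t < 3 / 2 * (h t * p y)"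
    if "y \<ge> K" "t \<in> S" "t > 0" for y t
  proof -
    have "h t * p y > 0" using h_pos[of t] p_pos[of y] that by simp
    moreover have "1/2 < \<kappa> y t / (h t * p y)" "\<kappa> y t / (h t * p y) < 3/2"
      using K(3)[OF that(1,2)] unfolding dist_real_def abs_less_iff by linarith+
    ultimately show "h t * p y / 2 < \<kappa> y t" "\<kappa> y t < 3 / 2 * (h t * p y)"
      by (simp_all add: field_simps)
  qed
  have lim: "((\<lambda>\<delta>. \<nu> y t \<delta> / \<mu> t \<delta>) \<longlongrightarrow> \<kappa> y t) (at_right 0)" if "y \<ge> K" "t \<in> S" for y t
  proof -
    have eq: "(\<lambda>\<delta>. \<nu> y t \<delta> / \<mu> t \<delta>) = (\<lambda>\<delta>. \<P>(\<omega> in M. X \<omega> > y \<bar> T \<omega> \<in> {t - \<delta>..t + \<delta>}))"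
      by (simp add: cond_prob_def \<nu>_def \<mu>_def)
    from K(2)[OF that] obtain l where l: "((\<lambda>\<delta>. \<nu> y t \<delta> / \<mu> t \<delta>) \<longlongrightarrow> l) (at_right 0)"
      unfolding cond_prob_at_defined_def eq by blast
    then have "l = \<kappa> y t"
      unfolding \<kappa>_def cond_prob_at_def eq[symmetric] by (simp add: tendsto_Lim)
    with l show ?thesis by simp
  qed
  \<comment> \<open>An interval around a positive support point that is charged by \<open>\<nu> K\<close>. With all radii at
    most \<open>\<theta> / 4\<close>, the intervals used below stay to the right of \<open>\<theta> / 4\<close>.\<close>
  obtain \<theta> where \<theta>: "\<theta> \<in> S" "\<theta> > 0"
    using ex_pos_support_point[OF T nonneg nondeg] unfolding S_def by blast
  have small: "\<forall>\<^sub>F \<delta> in at_right 0. 0 < \<delta> \<and> \<delta> \<le> \<theta> / 4"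
    unfolding eventually_at_right_field using \<theta> by (intro exI[of _ "\<theta>/4"]) auto
  have "0 < h \<theta> * p K" using h_pos[of \<theta>] p_pos[of K] \<theta> by simp
  then have "0 < \<kappa> K \<theta>" using \<kappa>_bounds(1)[OF order_refl \<theta>] by linarith
  then have "\<forall>\<^sub>F \<delta> in at_right 0. 0 < \<nu> K \<theta> \<delta> / \<mu> \<theta> \<delta>"
    by (rule order_tendstoD(1)[OF lim[OF order_refl \<theta>(1)]])
  with small have "\<forall>\<^sub>F \<delta> in at_right 0. (0 < \<delta> \<and> \<delta> \<le> \<theta> / 4) \<and> 0 < \<nu> K \<theta> \<delta> / \<mu> \<theta> \<delta>"
    by (rule eventually_conj)
  then obtain \<delta>\<^sub>0 where \<delta>\<^sub>0: "0 < \<delta>\<^sub>0" "\<delta>\<^sub>0 \<le> \<theta> / 4" "0 < \<nu> K \<theta> \<delta>\<^sub>0 / \<mu> \<theta> \<delta>\<^sub>0"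
    using eventually_happens trivial_limit_at_right_real by blast
  have \<nu>_pos: "\<nu> K \<theta> \<delta>\<^sub>0 > 0"
    using \<delta>\<^sub>0(3) \<mu>_pos[OF \<theta>(1) \<delta>\<^sub>0(1)] by (simp add: zero_less_divide_iff)
  \<comment> \<open>The factor 6 is 3, from the ratio of the bounds \<open>1 / 2\<close> and \<open>3 / 2\<close> in \<open>\<kappa>_bounds\<close>, times the
    2 of the covering argument.\<close>
  define c where "c = \<nu> K \<theta> \<delta>\<^sub>0 / (6 * p K)"
  have "c * p y \<le> \<P>(\<omega> in M. X \<omega> > y \<and> T \<omega> > \<theta> / 4)" if y: "y \<ge> K" for y
  proof -
    have "p y / (3 * p K) * prob {\<omega>\<in>space M. X \<omega> > K \<and> T \<omega> \<in> {\<theta> - \<delta>\<^sub>0..\<theta> + \<delta>\<^sub>0}}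
      \<le> 2 * prob {\<omega>\<in>space M. X \<omega> > y \<and> T \<omega> \<in> {\<theta> - \<delta>\<^sub>0 - \<theta>/4..\<theta> + \<delta>\<^sub>0 + \<theta>/4}}"
    proof (rule measure_compare_centred_intervals)
      fix t assume t: "t \<in> {\<theta> - \<delta>\<^sub>0..\<theta> + \<delta>\<^sub>0}"
      then have t_pos: "t > 0" using \<delta>\<^sub>0 \<theta> by auto
      have "\<exists>\<delta>>0. \<delta> \<le> \<theta> / 4 \<and> p y / (3 * p K) * \<nu> K t \<delta> \<le> \<nu> y t \<delta>"
      proof (cases "t \<in> S")
        case True
        from order_tendstoD(1)[OF lim[OF y True] \<kappa>_bounds(1)[OF y True t_pos]]
          order_tendstoD(2)[OF lim[OF order_refl True] \<kappa>_bounds(2)[OF order_refl True t_pos]] small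
        have "\<forall>\<^sub>F \<delta> in at_right 0. (0 < \<delta> \<and> \<delta> \<le> \<theta> / 4) \<and>
            h t * p y / 2 < \<nu> y t \<delta> / \<mu> t \<delta> \<and> \<nu> K t \<delta> / \<mu> t \<delta> < 3 / 2 * (h t * p K)"
          by eventually_elim simp
        then obtain \<delta> where \<delta>: "0 < \<delta>" "\<delta> \<le> \<theta> / 4"
          "h t * p y / 2 < \<nu> y t \<delta> / \<mu> t \<delta>" "\<nu> K t \<delta> / \<mu> t \<delta> < 3 / 2 * (h t * p K)"
          using eventually_happens trivial_limit_at_right_real by blast
        note m = \<mu>_pos[OF True \<delta>(1)]
        have "\<nu> K t \<delta> \<le> 3 / 2 * (h t * p K) * \<mu> t \<delta>"
          using \<delta>(4) m by (simp add: field_simps)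
        then have "p y / (3 * p K) * \<nu> K t \<delta> \<le> p y / (3 * p K) * (3 / 2 * (h t * p K) * \<mu> t \<delta>)"
          using p_pos[OF y] p_pos[of K] by (intro mult_left_mono) auto
        also have "\<dots> = h t * p y / 2 * \<mu> t \<delta>"
          using p_pos[of K] by simp
        also have "\<dots> \<le> \<nu> y t \<delta>"
          using \<delta>(3) m by (simp add: field_simps)
        finally show ?thesis using \<delta> by blast
      next
        case False
        \<comment> \<open>Off the support both sides vanish on a small interval.\<close>
        then obtain \<delta>1 where d1: "\<delta>1 > 0" "\<And>\<delta>. \<delta> \<le> \<delta>1 \<Longrightarrow> \<mu> t \<delta> = 0"
          unfolding S_def \<mu>_def using measure_null_off_support[OF T] by metis
        have "\<nu> K t \<delta> \<le> \<mu> t \<delta>" for \<delta>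
          unfolding \<nu>_def \<mu>_def by (intro finite_measure_mono) auto
        then have "\<nu> K t (min \<delta>1 (\<theta>/4)) = 0"
          using d1(2)[of "min \<delta>1 (\<theta>/4)"] \<nu>_nonneg[of K t "min \<delta>1 (\<theta>/4)"]
          by (metis min.cobounded1 order_antisym)
        then show ?thesis
          using d1(1) \<theta> \<nu>_nonneg by (intro exI[of _ "min \<delta>1 (\<theta>/4)"]) auto
      qed
      then show "\<exists>\<delta>>0. \<delta> \<le> \<theta> / 4 \<and>
        p y / (3 * p K) * prob {\<omega>\<in>space M. X \<omega> > K \<and> T \<omega> \<in> {t - \<delta>..t + \<delta>}}
        \<le> prob {\<omega>\<in>space M. X \<omega> > y \<and> T \<omega> \<in> {t - \<delta>..t + \<delta>}}"
        by (simp add: \<nu>_def)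
    qed (use p_pos[OF y] p_pos[of K] in auto)
    also have "\<dots> \<le> 2 * \<P>(\<omega> in M. X \<omega> > y \<and> T \<omega> > \<theta> / 4)"
      using \<theta> \<delta>\<^sub>0 by (intro mult_left_mono finite_measure_mono) auto
    finally show ?thesis by (simp add: c_def \<nu>_def mult.commute)
  qed
  then have "\<forall>\<^sub>F y in at_top. c * p y \<le> \<P>(\<omega> in M. X \<omega> > y \<and> T \<omega> > \<theta> / 4)"
    unfolding eventually_at_top_linorder by blast
  moreover have "c > 0" using \<nu>_pos p_pos[of K] by (simp add: c_def)
  ultimately show thesis using \<theta> that[of "\<theta> / 4" c] by (simp add: p_def)
qed

lemma tail_cdf_distr:
  assumes [measurable]: "X \<in> borel_measurable M"
  shows "tail (cdf (distr M borel X)) x = \<P>(\<omega> in M. X \<omega> > x)"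
proof -
  have "prob (X -` {..x} \<inter> space M) = 1 - \<P>(\<omega> in M. X \<omega> > x)"
    by (subst prob_compl[symmetric]) (auto intro!: arg_cong[where f=prob])
  then show ?thesis by (simp add: tail_def cdf_def measure_distr)
qed

text \<open>
  The tail of \<open>X\<close>, at an argument rescaled by any positive constant, is dominated by the tail of the
  product \<open>T X\<close>.
\<close>

lemma tail_product_ge:
  fixes X T :: "'a \<Rightarrow> real" and h :: "real \<Rightarrow> real"
  assumes X[measurable]: "X \<in> borel_measurable M" and T[measurable]: "T \<in> borel_measurable M"
    and X_tail: "\<And>x. 0 \<le> x \<Longrightarrow> \<P>(\<omega> in M. X \<omega> > x) > 0"
    and dom: "dominatedly_varying (cdf (distr M borel X))"
    and nonneg: "AE \<omega> in M. T \<omega> \<ge> 0" and nondeg: "\<not> (AE \<omega> in M. T \<omega> = 0)"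
    and h_pos: "\<And>\<theta>. 0 \<le> \<theta> \<Longrightarrow> h \<theta> > 0"
    and h_defined: "\<forall>\<^sub>F x in at_top. \<forall>\<theta>\<in>rv_support M T.
      cond_prob_at_defined M (\<lambda>\<omega>. X \<omega> > x) T \<theta>"
    and h_asymp: "unif_asymp_equiv at_top (rv_support M T)
      (\<lambda>x \<theta>. cond_prob_at M (\<lambda>\<omega>. X \<omega> > x) T \<theta>) (\<lambda>x \<theta>. h \<theta> * \<P>(\<omega> in M. X \<omega> > x))"
    and B: "B > 0"
  obtains C where "C > 0"
    "\<forall>\<^sub>F x in at_top. \<P>(\<omega> in M. X \<omega> > x / B) \<le> C * \<P>(\<omega> in M. T \<omega> * X \<omega> > x)"
proof -
  obtain a c where ac: "a > 0" "c > 0"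
    and low: "\<forall>\<^sub>F y in at_top. c * \<P>(\<omega> in M. X \<omega> > y) \<le> \<P>(\<omega> in M. X \<omega> > y \<and> T \<omega> > a)"
    using joint_tail_ge_marginal_tail[OF X T X_tail nonneg nondeg h_pos h_defined h_asymp] by blast
  \<comment> \<open>Dominated variation needs a factor below 1, but \<open>a < B\<close> is not known.\<close>
  define \<beta> where "\<beta> = min (a / B) (1 / 2)"
  have \<beta>: "\<beta> \<in> {0<..<1}" using ac B by (auto simp: \<beta>_def)
  have "Limsup at_top (\<lambda>x. ereal (\<P>(\<omega> in M. X \<omega> > \<beta> * x) / \<P>(\<omega> in M. X \<omega> > x))) < \<infinity>"
    using dom \<beta> unfolding dominatedly_varying_def by (simp add: tail_cdf_distr)
  from ereal_dense2[OF this] obtain D where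
    "Limsup at_top (\<lambda>x. ereal (\<P>(\<omega> in M. X \<omega> > \<beta> * x) / \<P>(\<omega> in M. X \<omega> > x))) < ereal D"
    by blast
  from Limsup_lessD[OF this]
  have D: "\<forall>\<^sub>F x in at_top. \<P>(\<omega> in M. X \<omega> > \<beta> * x) / \<P>(\<omega> in M. X \<omega> > x) < D" by simp
  have at: "filterlim (\<lambda>x. x / a) at_top at_top"
    using filterlim_at_top_mult_tendsto_pos[OF tendsto_const[of "1 / a"] _ filterlim_ident] ac by simp
  from eventually_compose_filterlim[OF eventually_conj[OF low D] at] eventually_ge_at_top[of 0]
  have "\<forall>\<^sub>F x in at_top. \<P>(\<omega> in M. X \<omega> > x / B) \<le> max D 1 / c * \<P>(\<omega> in M. T \<omega> * X \<omega> > x)"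
  proof eventually_elim
    case (elim x)
    have pos: "\<P>(\<omega> in M. X \<omega> > x / a) > 0" using X_tail elim ac by simp
    have "\<beta> * (x / a) \<le> a / B * (x / a)"
      using elim ac by (intro mult_right_mono) (auto simp: \<beta>_def)
    then have "\<beta> * (x / a) \<le> x / B" using ac by simp
    then have "\<P>(\<omega> in M. X \<omega> > x / B) \<le> \<P>(\<omega> in M. X \<omega> > \<beta> * (x / a))"
      by (intro finite_measure_mono) auto
    also have "\<dots> \<le> D * \<P>(\<omega> in M. X \<omega> > x / a)"
      using elim pos by (simp add: field_simps)
    also have "\<dots> \<le> max D 1 * \<P>(\<omega> in M. X \<omega> > x / a)"
      by (intro mult_right_mono) auto
    also have "\<dots> = max D 1 / c * (c * \<P>(\<omega> in M. X \<omega> > x / a))" using ac by simp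
    also have "\<dots> \<le> max D 1 / c * \<P>(\<omega> in M. X \<omega> > x / a \<and> T \<omega> > a)"
      using elim ac by (intro mult_left_mono) auto
    also have "\<dots> \<le> max D 1 / c * \<P>(\<omega> in M. T \<omega> * X \<omega> > x)"
    proof (intro mult_left_mono finite_measure_mono subsetI; clarsimp?)
      fix \<omega> assume w: "x / a < X \<omega>" "a < T \<omega>"
      have "x < a * X \<omega>" using w ac by (simp add: field_simps)
      also have "\<dots> \<le> T \<omega> * X \<omega>"
      proof (rule mult_right_mono)
        have "0 \<le> x / a" using elim ac by simp
        then show "0 \<le> X \<omega>" using w by linarith
      qed (use w in simp)
      finally show "x < T \<omega> * X \<omega>" .
    qed (use ac in auto)
    finally show ?case .
  qed
  moreover have "max D 1 / c > 0" using ac by simp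
  ultimately show thesis using that by blast
qed

lemma tail_tendsto_0:
  fixes Y :: "'a \<Rightarrow> real"
  assumes [measurable]: "Y \<in> borel_measurable M"
  shows "((\<lambda>x. \<P>(\<omega> in M. Y \<omega> > x)) \<longlongrightarrow> 0) at_top"
proof -
  interpret D: real_distribution "distr M borel Y" by simp
  have "((\<lambda>x. 1 - cdf (distr M borel Y) x) \<longlongrightarrow> 1 - 1) at_top"
    by (intro tendsto_intros D.cdf_lim_at_top_prob)
  then show ?thesis
    using tail_cdf_distr[of Y] by (simp add: tail_def)
qed

end

section \<open>Limits in two variables and boundedness of the weights\<close>

lemma eventually_min_at_top:
  "eventually P min_at_top \<longleftrightarrow> (\<exists>K. \<forall>x\<ge>K. \<forall>y\<ge>K. P (x, y))"
  unfolding min_at_top_def eventually_filtercomap eventually_at_top_linorder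
  by (auto simp: min_le_iff_disj) (metis min.bounded_iff order_refl)+

lemma filterlim_divide_min_at_top:
  assumes "B > 0"
  shows "filterlim (\<lambda>(x, y). (x / B, y / B)) min_at_top min_at_top"
  unfolding filterlim_iff eventually_min_at_top
proof (intro allI impI)
  fix R :: "real \<times> real \<Rightarrow> bool"
  assume "\<exists>K. \<forall>x\<ge>K. \<forall>y\<ge>K. R (x, y)"
  then obtain K where K: "\<And>x y. x \<ge> K \<Longrightarrow> y \<ge> K \<Longrightarrow> R (x, y)" by blast
  have "R (x / B, y / B)" if "x \<ge> B * K" "y \<ge> B * K" for x y
    using that assms by (intro K) (auto simp: field_simps)
  then show "\<exists>K. \<forall>x\<ge>K. \<forall>y\<ge>K. R (case (x, y) of (x, y) \<Rightarrow> (x / B, y / B))"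
    by auto
qed

context prob_space
begin

text \<open>
  The left-hand side of the assumption is constant in \<open>y\<close> and the right-hand side tends to \<open>0\<close> as
  \<open>y\<close> grows, so the left-hand side vanishes for large \<open>x\<close>.
\<close>

lemma bounded_if_tail_smallo_joint_tail:
  fixes Y Z S :: "'a \<Rightarrow> real" and b :: "real \<Rightarrow> real"
  assumes [measurable]: "Y \<in> borel_measurable M" "Z \<in> borel_measurable M" "S \<in> borel_measurable M"
    and small: "(\<lambda>(x, y). \<P>(\<omega> in M. S \<omega> > b x))
      \<in> o[min_at_top](\<lambda>(x, y). \<P>(\<omega> in M. Y \<omega> > x \<and> Z \<omega> > y))"
  obtains B where "B > 0" "AE \<omega> in M. S \<omega> \<le> B"
proof -
  from landau_o.smallD[OF small, of 1] obtain K where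
    K: "\<And>x y. x \<ge> K \<Longrightarrow> y \<ge> K \<Longrightarrow> \<P>(\<omega> in M. S \<omega> > b x) \<le> \<P>(\<omega> in M. Y \<omega> > x \<and> Z \<omega> > y)"
    by (auto simp: eventually_min_at_top)
  have "\<P>(\<omega> in M. S \<omega> > b K) \<le> 0"
  proof (rule tendsto_lowerbound[OF tail_tendsto_0[of Z]])
    show "\<forall>\<^sub>F y in at_top. \<P>(\<omega> in M. S \<omega> > b K) \<le> \<P>(\<omega> in M. Z \<omega> > y)"
      using eventually_ge_at_top[of K]
    proof eventually_elim
      case (elim y)
      have "\<P>(\<omega> in M. S \<omega> > b K) \<le> \<P>(\<omega> in M. Y \<omega> > K \<and> Z \<omega> > y)" using K elim by simp
      also have "\<dots> \<le> \<P>(\<omega> in M. Z \<omega> > y)" by (intro finite_measure_mono) auto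
      finally show ?case .
    qed
  qed auto
  then have "\<P>(\<omega> in M. S \<omega> > b K) = 0" using measure_nonneg order_antisym by blast
  then have "AE \<omega> in M. \<not> S \<omega> > b K"
    by (intro AE_not_if_prob_0) measurable
  then have "AE \<omega> in M. S \<omega> \<le> max (b K) 1" by eventually_elim auto
  then show thesis using that[of "max (b K) 1"] by simp
qed

end

section \<open>Asymptotic independence of products\<close>

lemma less_mult_bound:
  fixes x t u B :: real
  assumes "x < t * u" "0 \<le> t" "t \<le> B" "0 \<le> x"
  shows "x < B * u"
proof -
  have "u > 0"
    using assms mult_nonneg_nonpos[of t u] by (cases "u > 0") auto
  then have "t * u \<le> B * u" using assms by (intro mult_right_mono) auto
  with assms show ?thesis by simp
qed

theorem theorem3p1:
  fixes M :: "'a measure" and n :: nat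
    and X \<Theta> :: "nat \<Rightarrow> 'a \<Rightarrow> real"
    and F b h :: "nat \<Rightarrow> real \<Rightarrow> real"
    and g :: "nat \<Rightarrow> nat \<Rightarrow> real \<times> real \<Rightarrow> real"
    and L U :: real
  assumes "prob_space M"
    and X_rv: "\<And>i. i \<in> {1..n} \<Longrightarrow> X i \<in> borel_measurable M"
    and F_def: "\<And>i. i \<in> {1..n} \<Longrightarrow> F i = cdf (distr M borel (X i))"
    and F_tail_pos: "\<And>i x. i \<in> {1..n} \<Longrightarrow> 0 \<le> x \<Longrightarrow> tail (F i) x > 0"
    and F_dom: "\<And>i. i \<in> {1..n} \<Longrightarrow> dominatedly_varying (F i)"
    and Theta_rv: "\<And>i. i \<in> {1..n} \<Longrightarrow> \<Theta> i \<in> borel_measurable M"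
    and Theta_nonneg: "\<And>i. i \<in> {1..n} \<Longrightarrow> AE \<omega> in M. \<Theta> i \<omega> \<ge> 0"
    and Theta_nondeg: "\<And>i. i \<in> {1..n} \<Longrightarrow> \<not> (AE \<omega> in M. \<Theta> i \<omega> = 0)"
    and b_pos: "\<And>i x. i \<in> {1..n} \<Longrightarrow> 0 \<le> x \<Longrightarrow> b i x > 0"
    and b_lim: "\<And>i. i \<in> {1..n} \<Longrightarrow> filterlim (b i) at_top at_top"
    and b_lim': "\<And>i. i \<in> {1..n} \<Longrightarrow> ((\<lambda>x. b i x / x) \<longlongrightarrow> 0) at_top"
    and b_small: "\<And>i j. i \<in> {1..n} \<Longrightarrow> j \<in> {1..n} \<Longrightarrow> i \<noteq> j \<Longrightarrow>
      (\<lambda>(x\<^sub>i, x\<^sub>j). \<P>(\<omega> in M. \<Theta> i \<omega> > b i x\<^sub>i)) \<in> o[min_at_top](\<lambda>(x\<^sub>i, x\<^sub>j).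
         \<P>(\<omega> in M. \<Theta> i \<omega> * X i \<omega> > x\<^sub>i \<and> \<Theta> j \<omega> * X j \<omega> > x\<^sub>j))"
    and h_pos: "\<And>i \<theta>. i \<in> {1..n} \<Longrightarrow> 0 \<le> \<theta> \<Longrightarrow> h i \<theta> > 0"
    and h_defined: "\<And>i. i \<in> {1..n} \<Longrightarrow>
      \<forall>\<^sub>F x in at_top. \<forall>\<theta>\<in>rv_support M (\<Theta> i).
        cond_prob_at_defined M (\<lambda>\<omega>. X i \<omega> > x) (\<Theta> i) \<theta>"
    and h_asymp: "\<And>i. i \<in> {1..n} \<Longrightarrow>
      unif_asymp_equiv at_top (rv_support M (\<Theta> i))
        (\<lambda>x \<theta>. cond_prob_at M (\<lambda>\<omega>. X i \<omega> > x) (\<Theta> i) \<theta>)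
        (\<lambda>x \<theta>. h i \<theta> * \<P>(\<omega> in M. X i \<omega> > x))"
    and g_meas: "\<And>i j. i \<in> {1..n} \<Longrightarrow> j \<in> {1..n} \<Longrightarrow> i \<noteq> j \<Longrightarrow>
      g i j \<in> borel_measurable (restrict_space borel ({0..} \<times> {0..}))"
    and g_pos: "\<And>i j \<theta>\<^sub>i \<theta>\<^sub>j. i \<in> {1..n} \<Longrightarrow> j \<in> {1..n} \<Longrightarrow> i \<noteq> j \<Longrightarrow>
      0 \<le> \<theta>\<^sub>i \<Longrightarrow> 0 \<le> \<theta>\<^sub>j \<Longrightarrow> g i j (\<theta>\<^sub>i, \<theta>\<^sub>j) > 0"
    and LU: "0 < L" "L \<le> U"
    and g_defined: "\<And>i j. i \<in> {1..n} \<Longrightarrow> j \<in> {1..n} \<Longrightarrow> i \<noteq> j \<Longrightarrow>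
      \<forall>\<^sub>F (x\<^sub>i, x\<^sub>j) in min_at_top. \<forall>\<theta>\<in>rv_support M (\<Theta> i) \<times> rv_support M (\<Theta> j).
        cond_prob_at2_defined M (\<lambda>\<omega>. \<bar>X i \<omega>\<bar> > x\<^sub>i \<and> X j \<omega> > x\<^sub>j) (\<Theta> i) (\<Theta> j) \<theta> \<and>
        cond_prob_at2_defined M (\<lambda>\<omega>. X i \<omega> > x\<^sub>i \<and> X j \<omega> > x\<^sub>j) (\<Theta> i) (\<Theta> j) \<theta>"
    and g_asymp: "\<And>i j. i \<in> {1..n} \<Longrightarrow> j \<in> {1..n} \<Longrightarrow> i \<noteq> j \<Longrightarrow>
      unif_asymp_equiv min_at_top (rv_support M (\<Theta> i) \<times> rv_support M (\<Theta> j))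
        (\<lambda>(x\<^sub>i, x\<^sub>j) \<theta>. cond_prob_at2 M (\<lambda>\<omega>. \<bar>X i \<omega>\<bar> > x\<^sub>i \<and> X j \<omega> > x\<^sub>j) (\<Theta> i) (\<Theta> j) \<theta>)
        (\<lambda>(x\<^sub>i, x\<^sub>j) \<theta>. g i j \<theta> * \<P>(\<omega> in M. \<bar>X i \<omega>\<bar> > x\<^sub>i \<and> X j \<omega> > x\<^sub>j))"
    and g_lower: "\<And>i j. i \<in> {1..n} \<Longrightarrow> j \<in> {1..n} \<Longrightarrow> i \<noteq> j \<Longrightarrow>
      unif_lesssim min_at_top (rv_support M (\<Theta> i) \<times> rv_support M (\<Theta> j))
        (\<lambda>(x\<^sub>i, x\<^sub>j) \<theta>. L * g i j \<theta> * \<P>(\<omega> in M. X i \<omega> > x\<^sub>i \<and> X j \<omega> > x\<^sub>j))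
        (\<lambda>(x\<^sub>i, x\<^sub>j) \<theta>. cond_prob_at2 M (\<lambda>\<omega>. X i \<omega> > x\<^sub>i \<and> X j \<omega> > x\<^sub>j) (\<Theta> i) (\<Theta> j) \<theta>)"
    and g_upper: "\<And>i j. i \<in> {1..n} \<Longrightarrow> j \<in> {1..n} \<Longrightarrow> i \<noteq> j \<Longrightarrow>
      unif_lesssim min_at_top (rv_support M (\<Theta> i) \<times> rv_support M (\<Theta> j))
        (\<lambda>(x\<^sub>i, x\<^sub>j) \<theta>. cond_prob_at2 M (\<lambda>\<omega>. X i \<omega> > x\<^sub>i \<and> X j \<omega> > x\<^sub>j) (\<Theta> i) (\<Theta> j) \<theta>)
        (\<lambda>(x\<^sub>i, x\<^sub>j) \<theta>. U * g i j \<theta> * \<P>(\<omega> in M. X i \<omega> > x\<^sub>i \<and> X j \<omega> > x\<^sub>j))"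
  shows "(pTAI M {1..n} X \<longrightarrow> pTAI M {1..n} (\<lambda>i \<omega>. \<Theta> i \<omega> * X i \<omega>)) \<and>
         (pQAI M {1..n} X \<longrightarrow> pQAI M {1..n} (\<lambda>i \<omega>. \<Theta> i \<omega> * X i \<omega>))"
proof -
  interpret prob_space M by fact
  note [measurable] = X_rv Theta_rv
  define P where "P i x = \<P>(\<omega> in M. X i \<omega> > x)" for i x
  define PT where "PT i x = \<P>(\<omega> in M. \<Theta> i \<omega> * X i \<omega> > x)" for i x
  have P_pos: "P i x > 0" if "i \<in> {1..n}" "0 \<le> x" for i x
    using F_tail_pos[OF that] tail_cdf_distr[OF X_rv[OF that(1)], of x]
    unfolding F_def[OF that(1)] P_def by simp
  have PT_nonneg: "PT i x \<ge> 0" for i x by (simp add: PT_def)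
  have common: "\<exists>B>0. \<exists>C>0. (AE \<omega> in M. 0 \<le> \<Theta> i \<omega> \<and> \<Theta> i \<omega> \<le> B \<and> 0 \<le> \<Theta> j \<omega> \<and> \<Theta> j \<omega> \<le> B) \<and>
      (\<forall>\<^sub>F x in at_top. P i (x / B) \<le> C * PT i x) \<and> (\<forall>\<^sub>F x in at_top. P j (x / B) \<le> C * PT j x)"
    if i: "i \<in> {1..n}" and j: "j \<in> {1..n}" and ij: "i \<noteq> j" for i j
  proof -
    have m: "(\<lambda>\<omega>. \<Theta> k \<omega> * X k \<omega>) \<in> borel_measurable M" if "k \<in> {1..n}" for k
      using that by measurable
    obtain Bi where Bi: "Bi > 0" "AE \<omega> in M. \<Theta> i \<omega> \<le> Bi"
      using bounded_if_tail_smallo_joint_tail[OF m[OF i] m[OF j] Theta_rv[OF i] b_small[OF i j ij]]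
      by blast
    obtain Bj where Bj: "Bj > 0" "AE \<omega> in M. \<Theta> j \<omega> \<le> Bj"
      using bounded_if_tail_smallo_joint_tail[OF m[OF j] m[OF i] Theta_rv[OF j] b_small[OF j i ij[symmetric]]]
      by blast
    define B where "B = max Bi Bj"
    have B: "B > 0" using Bi by (simp add: B_def)
    have "AE \<omega> in M. 0 \<le> \<Theta> i \<omega> \<and> \<Theta> i \<omega> \<le> B \<and> 0 \<le> \<Theta> j \<omega> \<and> \<Theta> j \<omega> \<le> B"
      using Bi(2) Bj(2) Theta_nonneg[OF i] Theta_nonneg[OF j] by eventually_elim (auto simp: B_def)
    moreover have ex: "\<exists>C>0. \<forall>\<^sub>F x in at_top. P k (x / B) \<le> C * PT k x" if k: "k \<in> {1..n}" for k
    proof -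
      have dom: "dominatedly_varying (cdf (distr M borel (X k)))"
        using F_dom[OF k] F_def[OF k] by simp
      show ?thesis
        unfolding P_def PT_def
        by (rule tail_product_ge[OF X_rv[OF k] Theta_rv[OF k] P_pos[OF k, unfolded P_def] dom
            Theta_nonneg[OF k] Theta_nondeg[OF k] h_pos[OF k] h_defined[OF k] h_asymp[OF k] B]) blast+
    qed
    obtain Ci where Ci: "Ci > 0" "\<forall>\<^sub>F x in at_top. P i (x / B) \<le> Ci * PT i x"
      using ex[OF i] by blast
    obtain Cj where Cj: "Cj > 0" "\<forall>\<^sub>F x in at_top. P j (x / B) \<le> Cj * PT j x"
      using ex[OF j] by blast
    have "Ci * PT i x \<le> max Ci Cj * PT i x" "Cj * PT j x \<le> max Ci Cj * PT j x" for x
      by (auto intro!: mult_right_mono PT_nonneg)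
    note le_max = this
    have "\<forall>\<^sub>F x in at_top. P i (x / B) \<le> max Ci Cj * PT i x"
      using Ci(2) by (rule eventually_mono) (rule order_trans[OF _ le_max(1)])
    moreover have "\<forall>\<^sub>F x in at_top. P j (x / B) \<le> max Ci Cj * PT j x"
      using Cj(2) by (rule eventually_mono) (rule order_trans[OF _ le_max(2)])
    moreover have "max Ci Cj > 0" using Ci by simp
    ultimately show ?thesis using B by blast
  qed
  have "pTAI M {1..n} (\<lambda>i \<omega>. \<Theta> i \<omega> * X i \<omega>)" if X_TAI: "pTAI M {1..n} X"
    unfolding pTAI_def
  proof (intro ballI impI)
    fix i j assume i: "i \<in> {1..n}" and j: "j \<in> {1..n}" and ij: "i \<noteq> j"
    obtain B C where B: "B > 0" and C: "C > 0"
      and bd: "AE \<omega> in M. 0 \<le> \<Theta> i \<omega> \<and> \<Theta> i \<omega> \<le> B \<and> 0 \<le> \<Theta> j \<omega> \<and> \<Theta> j \<omega> \<le> B"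
      and Cj: "\<forall>\<^sub>F x in at_top. P j (x / B) \<le> C * PT j x"
      using common[OF i j ij] by blast
    from eventually_conj[OF eventually_ge_at_top[of 0] Cj] obtain K
      where K: "\<And>x. x \<ge> K \<Longrightarrow> 0 \<le> x" "\<And>x. x \<ge> K \<Longrightarrow> P j (x / B) \<le> C * PT j x"
      unfolding eventually_at_top_linorder by blast
    have PT_pos: "PT j x > 0" if "x \<ge> K" for x
    proof -
      have "0 < P j (x / B)" using P_pos[OF j] K(1) B that by simp
      also have "\<dots> \<le> C * PT j x" using K that by simp
      finally show ?thesis using C by (simp add: zero_less_mult_iff)
    qed
    define Q where "Q = (\<lambda>(x, y). \<P>(\<omega> in M. \<bar>X i \<omega>\<bar> > x \<bar> X j \<omega> > y))"
    have Q: "(Q \<longlongrightarrow> 0) min_at_top"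
      using X_TAI i j ij unfolding pTAI_def Q_def by blast
    from filterlim_compose[OF Q filterlim_divide_min_at_top[OF B]]
    have lim: "((\<lambda>z. C * Q (case z of (x, y) \<Rightarrow> (x / B, y / B))) \<longlongrightarrow> 0) min_at_top"
      by (intro tendsto_mult_right_zero)
    have le: "\<P>(\<omega> in M. \<bar>\<Theta> i \<omega> * X i \<omega>\<bar> > x \<bar> \<Theta> j \<omega> * X j \<omega> > y) \<le> C * Q (x / B, y / B)"
      if x: "x \<ge> K" and y: "y \<ge> K" for x y
    proof -
      have nn: "x \<ge> 0" "y \<ge> 0" using x y K by auto
      have "\<P>(\<omega> in M. \<bar>\<Theta> i \<omega> * X i \<omega>\<bar> > x \<and> \<Theta> j \<omega> * X j \<omega> > y)
        \<le> \<P>(\<omega> in M. \<bar>X i \<omega>\<bar> > x / B \<and> X j \<omega> > y / B)" (is "?N \<le> ?N'")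
      proof (rule finite_measure_mono_AE)
        show "AE \<omega> in M. \<omega> \<in> {\<omega>\<in>space M. \<bar>\<Theta> i \<omega> * X i \<omega>\<bar> > x \<and> \<Theta> j \<omega> * X j \<omega> > y} \<longrightarrow>
          \<omega> \<in> {\<omega>\<in>space M. \<bar>X i \<omega>\<bar> > x / B \<and> X j \<omega> > y / B}"
          using bd
        proof eventually_elim
          case (elim \<omega>)
          then show ?case
            using less_mult_bound[of x "\<Theta> i \<omega>" "\<bar>X i \<omega>\<bar>" B] less_mult_bound[of y "\<Theta> j \<omega>" "X j \<omega>" B] nn B
            by (auto simp: abs_mult field_simps)
        qed
      qed (use i j in measurable)
      have "\<P>(\<omega> in M. \<bar>\<Theta> i \<omega> * X i \<omega>\<bar> > x \<bar> \<Theta> j \<omega> * X j \<omega> > y) = ?N / PT j y"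
        by (simp add: cond_prob_def PT_def)
      also have "\<dots> \<le> ?N' / (P j (y / B) / C)"
      proof (rule frac_le)
        show "0 < P j (y / B) / C" using P_pos[OF j] nn B C by simp
        show "P j (y / B) / C \<le> PT j y" using K(2)[OF y] C by (simp add: field_simps)
      qed (use \<open>?N \<le> ?N'\<close> in auto)
      also have "\<dots> = C * Q (x / B, y / B)"
        by (simp add: Q_def cond_prob_def P_def)
      finally show ?thesis .
    qed
    have "((\<lambda>(x, y). \<P>(\<omega> in M. \<bar>\<Theta> i \<omega> * X i \<omega>\<bar> > x \<bar> \<Theta> j \<omega> * X j \<omega> > y)) \<longlongrightarrow> 0) min_at_top"
    proof (rule tendsto_sandwich[OF _ _ tendsto_const lim])
      show "\<forall>\<^sub>F z in min_at_top.
        0 \<le> (case z of (x, y) \<Rightarrow> \<P>(\<omega> in M. \<bar>\<Theta> i \<omega> * X i \<omega>\<bar> > x \<bar> \<Theta> j \<omega> * X j \<omega> > y))"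
        by (intro always_eventually) (auto simp: cond_prob_def)
      show "\<forall>\<^sub>F z in min_at_top.
        (case z of (x, y) \<Rightarrow> \<P>(\<omega> in M. \<bar>\<Theta> i \<omega> * X i \<omega>\<bar> > x \<bar> \<Theta> j \<omega> * X j \<omega> > y))
          \<le> C * Q (case z of (x, y) \<Rightarrow> (x / B, y / B))"
        unfolding eventually_min_at_top using le by auto
    qed
    moreover have "\<forall>\<^sub>F x in at_top. PT j x > 0"
      unfolding eventually_at_top_linorder using PT_pos by blast
    ultimately show "(\<forall>\<^sub>F x in at_top. \<P>(\<omega> in M. \<Theta> j \<omega> * X j \<omega> > x) > 0) \<and>
        ((\<lambda>(x\<^sub>i, x\<^sub>j). \<P>(\<omega> in M. \<bar>\<Theta> i \<omega> * X i \<omega>\<bar> > x\<^sub>i \<bar> \<Theta> j \<omega> * X j \<omega> > x\<^sub>j)) \<longlongrightarrow> 0)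
          min_at_top"
      by (simp add: PT_def)
  qed
  moreover have "pQAI M {1..n} (\<lambda>i \<omega>. \<Theta> i \<omega> * X i \<omega>)" if X_QAI: "pQAI M {1..n} X"
    unfolding pQAI_def
  proof (intro ballI impI)
    fix i j assume i: "i \<in> {1..n}" and j: "j \<in> {1..n}" and ij: "i \<noteq> j"
    obtain B C where B: "B > 0" and C: "C > 0"
      and bd: "AE \<omega> in M. 0 \<le> \<Theta> i \<omega> \<and> \<Theta> i \<omega> \<le> B \<and> 0 \<le> \<Theta> j \<omega> \<and> \<Theta> j \<omega> \<le> B"
      and Ci: "\<forall>\<^sub>F x in at_top. P i (x / B) \<le> C * PT i x"
      and Cj: "\<forall>\<^sub>F x in at_top. P j (x / B) \<le> C * PT j x"
      using common[OF i j ij] by blast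
    have sum: "\<forall>\<^sub>F x in at_top. 0 \<le> x \<and> 0 < P i (x / B) + P j (x / B) \<and>
        P i (x / B) + P j (x / B) \<le> C * (PT i x + PT j x)"
      using Ci Cj eventually_ge_at_top[of 0]
    proof eventually_elim
      case (elim x)
      then show ?case using P_pos[OF i, of "x / B"] P_pos[OF j, of "x / B"] B
        by (simp add: algebra_simps)
    qed
    have at: "filterlim (\<lambda>x. x / B) at_top at_top"
      using filterlim_at_top_mult_tendsto_pos[OF tendsto_const[of "1 / B"] _ filterlim_ident] B by simp
    \<comment> \<open>A rule for both quotients: \<open>N\<close> is the numerator for \<open>X\<close> and \<open>N'\<close> the one for the products.\<close>
    have transfer: "((\<lambda>x. N' x / (PT i x + PT j x)) \<longlongrightarrow> 0) at_top"
      if N: "((\<lambda>x. N x / (P i x + P j x)) \<longlongrightarrow> 0) at_top"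
        and nn: "\<And>x. 0 \<le> N' x" and le: "\<And>x. 0 \<le> x \<Longrightarrow> N' x \<le> N (x / B)" for N N' :: "real \<Rightarrow> real"
    proof (rule tendsto_sandwich[OF _ _ tendsto_const])
      show "((\<lambda>x. C * (N (x / B) / (P i (x / B) + P j (x / B)))) \<longlongrightarrow> 0) at_top"
        by (intro tendsto_mult_right_zero filterlim_compose[OF N at])
      show "\<forall>\<^sub>F x in at_top. 0 \<le> N' x / (PT i x + PT j x)"
        by (auto simp: nn PT_nonneg)
      show "\<forall>\<^sub>F x in at_top. N' x / (PT i x + PT j x)
          \<le> C * (N (x / B) / (P i (x / B) + P j (x / B)))"
        using sum
      proof eventually_elim
        case (elim x)
        have "N' x / (PT i x + PT j x) \<le> N (x / B) / ((P i (x / B) + P j (x / B)) / C)"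
          using elim C le[of x] order_trans[OF nn le[of x]]
          by (intro frac_le) (auto simp: field_simps)
        then show ?case by (simp add: mult.commute)
      qed
    qed
    have "((\<lambda>x. \<P>(\<omega> in M. max (\<Theta> i \<omega> * X i \<omega>) 0 > x \<and> max (\<Theta> j \<omega> * X j \<omega>) 0 > x) /
           (PT i x + PT j x)) \<longlongrightarrow> 0) at_top"
    proof (rule transfer)
      show "((\<lambda>x. \<P>(\<omega> in M. max (X i \<omega>) 0 > x \<and> max (X j \<omega>) 0 > x) /
          (P i x + P j x)) \<longlongrightarrow> 0) at_top"
        using X_QAI i j ij unfolding pQAI_def P_def by blast
      fix x :: real assume x: "0 \<le> x"
      show "\<P>(\<omega> in M. max (\<Theta> i \<omega> * X i \<omega>) 0 > x \<and> max (\<Theta> j \<omega> * X j \<omega>) 0 > x)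
        \<le> \<P>(\<omega> in M. max (X i \<omega>) 0 > x / B \<and> max (X j \<omega>) 0 > x / B)"
      proof (rule finite_measure_mono_AE)
        show "AE \<omega> in M.
          \<omega> \<in> {\<omega>\<in>space M. max (\<Theta> i \<omega> * X i \<omega>) 0 > x \<and> max (\<Theta> j \<omega> * X j \<omega>) 0 > x} \<longrightarrow>
          \<omega> \<in> {\<omega>\<in>space M. max (X i \<omega>) 0 > x / B \<and> max (X j \<omega>) 0 > x / B}"
          using bd
        proof eventually_elim
          case (elim \<omega>)
          then show ?case
            using less_mult_bound[of x "\<Theta> i \<omega>" "X i \<omega>" B] less_mult_bound[of x "\<Theta> j \<omega>" "X j \<omega>" B] x B
            by (auto simp: less_max_iff_disj field_simps)
        qed
      qed (use i j in measurable)
    qed simp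
    moreover have "((\<lambda>x. \<P>(\<omega> in M. - min (\<Theta> i \<omega> * X i \<omega>) 0 > x \<and> \<Theta> j \<omega> * X j \<omega> > x) /
           (PT i x + PT j x)) \<longlongrightarrow> 0) at_top"
    proof (rule transfer)
      show "((\<lambda>x. \<P>(\<omega> in M. - min (X i \<omega>) 0 > x \<and> X j \<omega> > x) / (P i x + P j x)) \<longlongrightarrow> 0) at_top"
        using X_QAI i j ij unfolding pQAI_def P_def by blast
      fix x :: real assume x: "0 \<le> x"
      show "\<P>(\<omega> in M. - min (\<Theta> i \<omega> * X i \<omega>) 0 > x \<and> \<Theta> j \<omega> * X j \<omega> > x)
        \<le> \<P>(\<omega> in M. - min (X i \<omega>) 0 > x / B \<and> X j \<omega> > x / B)"
      proof (rule finite_measure_mono_AE)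
        show "AE \<omega> in M.
          \<omega> \<in> {\<omega>\<in>space M. - min (\<Theta> i \<omega> * X i \<omega>) 0 > x \<and> \<Theta> j \<omega> * X j \<omega> > x} \<longrightarrow>
          \<omega> \<in> {\<omega>\<in>space M. - min (X i \<omega>) 0 > x / B \<and> X j \<omega> > x / B}"
          using bd
        proof eventually_elim
          case (elim \<omega>)
          have neg: "- min u 0 > y \<longleftrightarrow> - u > y" if "0 \<le> y" for u y :: real
            using that by (auto simp: min_def)
          from elim show ?case
            using less_mult_bound[of x "\<Theta> i \<omega>" "- X i \<omega>" B] less_mult_bound[of x "\<Theta> j \<omega>" "X j \<omega>" B] x B
            by (auto simp: neg field_simps)
        qed
      qed (use i j in measurable)
    qed simp
    moreover have "\<forall>\<^sub>F x in at_top. 0 < PT i x + PT j x"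
      using sum
    proof eventually_elim
      case (elim x)
      then have "0 < C * (PT i x + PT j x)" by linarith
      then show ?case using C by (simp add: zero_less_mult_iff)
    qed
    ultimately show
      "(\<forall>\<^sub>F x in at_top. \<P>(\<omega> in M. \<Theta> i \<omega> * X i \<omega> > x) + \<P>(\<omega> in M. \<Theta> j \<omega> * X j \<omega> > x) > 0) \<and>
       ((\<lambda>x. \<P>(\<omega> in M. max (\<Theta> i \<omega> * X i \<omega>) 0 > x \<and> max (\<Theta> j \<omega> * X j \<omega>) 0 > x) /
          (\<P>(\<omega> in M. \<Theta> i \<omega> * X i \<omega> > x) + \<P>(\<omega> in M. \<Theta> j \<omega> * X j \<omega> > x))) \<longlongrightarrow> 0) at_top \<and>
       ((\<lambda>x. \<P>(\<omega> in M. - min (\<Theta> i \<omega> * X i \<omega>) 0 > x \<and> \<Theta> j \<omega> * X j \<omega> > x) /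
          (\<P>(\<omega> in M. \<Theta> i \<omega> * X i \<omega> > x) + \<P>(\<omega> in M. \<Theta> j \<omega> * X j \<omega> > x))) \<longlongrightarrow> 0) at_top"
      unfolding PT_def by blast
  qed
  ultimately show ?thesis by blast
qed

end
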